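(* Let $G$ be a super edge-magic graph of size $|E(G)| = 2|V(G)|-3$ and girth $g(G)=3$. Then $|\sigma_G| = 1$, where $\sigma_G$ is the super edge-magic set of $G$.
   Context: Graphs are finite and simple. The notation $[a,b]$ denotes the set of integers $x$ with $a\le x\le b$. An edge-magic labeling of a graph $G$ is a bijection $f:V(G)\cup E(G)\to[1,|V(G)|+|E(G)|]$ such that $f(u)+f(v)+f(uv)$ equals a constant (the valence $\mathrm{val}(f)$ of $f$) for every $uv\in E(G)$. It is super edge-magic if moreover $f(V(G))=[1,|V(G)|]$, and $G$ is super edge-magic if it admits a super edge-magic labeling. For a graph $G$ of order $p$ and size $q$ (with $q\geq 1$), let $$S_G=\left\{\frac{\sum_{u\in V(G)}\deg(u)g(u)+\sum_{i=p+1}^{p+q} i}{q} : g:V(G)\to[1,p]\text{ bijective}\right\}.$$ If $\lceil\min S_G\rceil\le\lfloor\max S_G\rfloor$, the super edge-magic interval of $G$ is $I_G=[\lceil\min S_G\rceil,\lfloor\max S_G\rfloor]$. The super edge-magic set of $G$ is $$\sigma_G=\{k\in I_G : \text{there exists a super edge-magic labeling of } G\text{ with valence } k\}.$$ The girth of a graph is the length of its shortest cycle. *)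

theory Defs
  imports Complex_Main "HOL-Library.Extended_Nat" "HOL-Library.FuncSet"
begin

text \<open>A finite simple graph has vertex set \<open>V\<close> and edge set \<open>E\<close>, an edge being a two-element
  set of vertices.\<close>

locale fin_simple_graph =
  fixes V :: "'a set" and E :: "'a set set"
  assumes finite_vertices: "finite V"
    and edges: "E \<subseteq> {e. e \<subseteq> V \<and> card e = 2}"

definition degree :: "'a set set \<Rightarrow> 'a \<Rightarrow> nat" where
  "degree E u = card {e \<in> E. u \<in> e}"

text \<open>A cycle is represented by the list of its vertices in cyclic order.\<close>

definition is_cycle :: "'a set \<Rightarrow> 'a set set \<Rightarrow> 'a list \<Rightarrow> bool" where
  "is_cycle V E c \<longleftrightarrow> length c \<ge> 3 \<and> distinct c \<and> set c \<subseteq> V \<and>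
     (\<forall>i < length c. {c ! i, c ! (Suc i mod length c)} \<in> E)"

text \<open>The girth of an acyclic graph is \<open>\<infinity>\<close>.\<close>

definition girth :: "'a set \<Rightarrow> 'a set set \<Rightarrow> enat" where
  "girth V E = (INF c \<in> {c. is_cycle V E c}. enat (length c))"

text \<open>A labeling has as its domain the disjoint union \<open>V <+> E\<close>; the label of a vertex \<open>u\<close> is
  \<open>f (Inl u)\<close> and that of an edge \<open>e\<close> is \<open>f (Inr e)\<close>.\<close>

definition has_valence :: "'a set set \<Rightarrow> ('a + 'a set \<Rightarrow> nat) \<Rightarrow> nat \<Rightarrow> bool" where
  "has_valence E f k \<longleftrightarrow>
     (\<forall>u v. {u, v} \<in> E \<longrightarrow> f (Inl u) + f (Inl v) + f (Inr {u, v}) = k)"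

definition edge_magic_labeling :: "'a set \<Rightarrow> 'a set set \<Rightarrow> ('a + 'a set \<Rightarrow> nat) \<Rightarrow> bool" where
  "edge_magic_labeling V E f \<longleftrightarrow>
     bij_betw f (V <+> E) {1..card V + card E} \<and> (\<exists>k. has_valence E f k)"

text \<open>The valence is uniquely determined only if there is at least one edge.\<close>

definition valence :: "'a set set \<Rightarrow> ('a + 'a set \<Rightarrow> nat) \<Rightarrow> nat" where
  "valence E f = (THE k. has_valence E f k)"

definition super_edge_magic_labeling :: "'a set \<Rightarrow> 'a set set \<Rightarrow> ('a + 'a set \<Rightarrow> nat) \<Rightarrow> bool" where
  "super_edge_magic_labeling V E f \<longleftrightarrow>
     edge_magic_labeling V E f \<and> (\<lambda>u. f (Inl u)) ` V = {1..card V}"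

definition super_edge_magic :: "'a set \<Rightarrow> 'a set set \<Rightarrow> bool" where
  "super_edge_magic V E \<longleftrightarrow> (\<exists>f. super_edge_magic_labeling V E f)"

definition S_set :: "'a set \<Rightarrow> 'a set set \<Rightarrow> real set" where
  "S_set V E =
     {real ((\<Sum>u\<in>V. degree E u * g u) + (\<Sum>i = card V + 1..card V + card E. i)) / real (card E)
       | g. bij_betw g V {1..card V}}"

lemma finite_S_set:
  assumes "finite V"
  shows "finite (S_set V E)"
proof -
  define F where "F = (\<lambda>g. real ((\<Sum>u\<in>V. degree E u * g u)
    + (\<Sum>i = card V + 1..card V + card E. i)) / real (card E))"
  have "S_set V E \<subseteq> F ` (V \<rightarrow>\<^sub>E {1..card V})"
  proof
    fix x assume "x \<in> S_set V E"
    then obtain g where x: "x = F g" and g: "bij_betw g V {1..card V}"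
      unfolding S_set_def F_def by blast
    have "restrict g V \<in> V \<rightarrow>\<^sub>E {1..card V}"
      using bij_betw_imp_funcset[OF g] by (simp only: restrict_PiE_iff Pi_iff)
    moreover have "F (restrict g V) = F g"
    proof -
      have "(\<Sum>u\<in>V. degree E u * restrict g V u) = (\<Sum>u\<in>V. degree E u * g u)"
        by (rule sum.cong) simp_all
      then show ?thesis by (simp only: F_def)
    qed
    ultimately show "x \<in> F ` (V \<rightarrow>\<^sub>E {1..card V})" unfolding x by (metis imageI)
  qed
  moreover have "finite (V \<rightarrow>\<^sub>E {1..card V})" using assms by (intro finite_PiE) simp_all
  ultimately show ?thesis by (rule finite_subset[OF _ finite_imageI])
qed

lemma S_set_nonempty:
  assumes "finite V"
  shows "S_set V E \<noteq> {}"
proof -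
  obtain g where "bij_betw g V {1..card V}"
    using finite_same_card_bij[OF assms, of "{1..card V}"] by auto
  then show ?thesis unfolding S_set_def by blast
qed

text \<open>The integer interval below is empty if \<open>\<lceil>Min S\<rceil> > \<lfloor>Max S\<rfloor>\<close>.\<close>

definition super_edge_magic_interval :: "'a set \<Rightarrow> 'a set set \<Rightarrow> int set" where
  "super_edge_magic_interval V E = {\<lceil>Min (S_set V E)\<rceil>..\<lfloor>Max (S_set V E)\<rfloor>}"

definition super_edge_magic_set :: "'a set \<Rightarrow> 'a set set \<Rightarrow> int set" where
  "super_edge_magic_set V E =
     {k \<in> super_edge_magic_interval V E.
        \<exists>f. super_edge_magic_labeling V E f \<and> int (valence E f) = k}"

end

(* The edge labels of a super edge-magic labeling f fill [p+1, p+q] = [p+1, 3p-3], while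
   f(u) + f(v) lies in [3, 2p-1] for every edge uv.  The edge labelled p+1 gives val(f) \<le> 3p and
   the edge labelled 3p-3 gives val(f) \<ge> 3p.  Hence 3p is the only possible valence.  Summing the
   magic condition over all edges shows that it lies in S_G, hence in the interval I_G. *)
theory Submission imports Defs
begin

text \<open>Double counting of incident pairs: \<open>g u\<close> occurs once for each edge through
  \<open>u\<close>. This turns a sum over edges into the degree-weighted sum that appears in
  \<open>S_set\<close>.\<close>

lemma sum_edges_eq_sum_degree:
  fixes g :: "'a \<Rightarrow> nat"
  assumes "finite V" and "E \<subseteq> Pow V"
  shows "(\<Sum>e\<in>E. \<Sum>u\<in>e. g u) = (\<Sum>u\<in>V. degree E u * g u)"
proof -
  have "finite E" using assms by (meson finite_Pow_iff finite_subset)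
  have "(\<Sum>e\<in>E. \<Sum>u\<in>e. g u) = (\<Sum>e\<in>E. \<Sum>u | u \<in> V \<and> u \<in> e. g u)"
    using assms(2) by (intro sum.cong refl) auto
  also have "\<dots> = (\<Sum>u\<in>V. \<Sum>e | e \<in> E \<and> u \<in> e. g u)"
    by (rule sum.swap_restrict[OF \<open>finite E\<close> assms(1)])
  finally show ?thesis by (simp add: degree_def)
qed

lemma has_valence_unique:
  assumes "has_valence E f k" and "has_valence E f l" and "{u, v} \<in> E"
  shows "k = l"
  using assms unfolding has_valence_def by blast

text \<open>The edge excludes the vacuous case: over an empty edge set every number satisfies
  \<open>has_valence\<close>, and \<open>THE\<close> would pick out nothing definite.\<close>

lemma valence_eqI:
  assumes "has_valence E f k" and "{u, v} \<in> E"
  shows "valence E f = k"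
  unfolding valence_def
  using assms(1) has_valence_unique[OF _ assms(1) assms(2)] by (rule the_equality)

context fin_simple_graph
begin

lemma edge_obtain:
  assumes "e \<in> E"
  obtains u v where "e = {u, v}" and "u \<noteq> v" and "u \<in> V" and "v \<in> V"
proof -
  have "e \<subseteq> V" "card e = 2" using assms edges by auto
  then show ?thesis using that by (auto simp: card_2_iff)
qed

lemma vertex_labels_bij:
  assumes "super_edge_magic_labeling V E f"
  shows "bij_betw (\<lambda>u. f (Inl u)) V {1..card V}"
  unfolding bij_betw_def
proof
  show "(\<lambda>u. f (Inl u)) ` V = {1..card V}"
    using assms by (simp add: super_edge_magic_labeling_def)
  then show "inj_on (\<lambda>u. f (Inl u)) V"
    using finite_vertices by (simp add: eq_card_imp_inj_on)
qed

text \<open>Since \<open>f\<close> is injective and the vertices use up exactly the labels up to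
  \<open>card V\<close>, the edges receive precisely the remaining ones.\<close>

lemma edge_labels_bij:
  assumes "super_edge_magic_labeling V E f"
  shows "bij_betw (\<lambda>e. f (Inr e)) E {card V + 1..card V + card E}"
proof -
  have f: "inj_on f (V <+> E)" "f ` (V <+> E) = {1..card V + card E}"
    and V: "(\<lambda>u. f (Inl u)) ` V = {1..card V}"
    using assms
    by (auto simp: super_edge_magic_labeling_def edge_magic_labeling_def bij_betw_def)
  have "(\<lambda>e. f (Inr e)) ` E = f ` ((V <+> E) - Inl ` V)"
    by (auto simp: image_iff)
  also have "\<dots> = f ` (V <+> E) - f ` (Inl ` V)"
    by (rule inj_on_image_set_diff[OF f(1)]) auto
  also have "\<dots> = {card V + 1..card V + card E}"
    unfolding f(2) image_image V by auto
  finally show ?thesis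
    using f(1) unfolding bij_betw_def by (auto simp: inj_on_def)
qed

text \<open>Two distinct labels from \<open>{1..card V}\<close> sum to at least 1 + 2 and at most p
  + (p - 1), with p = \<open>card V\<close>. The upper bound is stated additively to avoid truncated
  subtraction.\<close>

lemma vertex_label_sum_bounds:
  assumes "super_edge_magic_labeling V E f" and "{u, v} \<in> E"
  shows "3 \<le> f (Inl u) + f (Inl v)" and "f (Inl u) + f (Inl v) + 1 \<le> 2 * card V"
proof -
  have uv: "u \<in> V" "v \<in> V" "u \<noteq> v" using edges assms(2) by auto
  note bij = vertex_labels_bij[OF assms(1)]
  have "f (Inl u) \<in> {1..card V}" "f (Inl v) \<in> {1..card V}"
    using bij_betw_apply[OF bij] uv by auto
  moreover have "f (Inl u) \<noteq> f (Inl v)"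
    using bij_betw_imp_inj_on[OF bij] uv by (auto dest: inj_onD)
  ultimately show "3 \<le> f (Inl u) + f (Inl v)" "f (Inl u) + f (Inl v) + 1 \<le> 2 * card V"
    by auto
qed

lemma label_attained:
  assumes "super_edge_magic_labeling V E f" and "i \<in> {card V + 1..card V + card E}"
  obtains u v where "{u, v} \<in> E" and "f (Inr {u, v}) = i"
proof -
  have "i \<in> (\<lambda>e. f (Inr e)) ` E"
    using assms(2) by (simp only: bij_betw_imp_surj_on[OF edge_labels_bij[OF assms(1)]])
  then obtain e where "e \<in> E" "f (Inr e) = i" by (elim imageE) simp
  moreover obtain u v where "e = {u, v}" using edge_obtain[OF \<open>e \<in> E\<close>] .
  ultimately show ?thesis using that by blast
qed

lemma valence_eq_3_card:
  assumes f: "super_edge_magic_labeling V E f" and k: "has_valence E f k"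
    and q: "card E + 3 = 2 * card V" and "E \<noteq> {}"
  shows "k = 3 * card V"
proof -
  have "0 < card E"
    using \<open>E \<noteq> {}\<close> edges finite_vertices by (simp add: card_gt_0_iff finite_subset)
  \<comment> \<open>With at least one edge, the smallest and the largest edge label both exist; they
    may coincide.\<close>
  then have ends: "card V + 1 \<in> {card V + 1..card V + card E}"
    "card V + card E \<in> {card V + 1..card V + card E}" by auto
  obtain u v where uv: "{u, v} \<in> E" "f (Inr {u, v}) = card V + 1"
    by (rule label_attained[OF f ends(1)])
  obtain x y where xy: "{x, y} \<in> E" "f (Inr {x, y}) = card V + card E"
    by (rule label_attained[OF f ends(2)])
  have "k = f (Inl u) + f (Inl v) + (card V + 1)" "k = f (Inl x) + f (Inl y) + (card V + card E)"
    using k[unfolded has_valence_def, rule_format, OF uv(1)]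
      k[unfolded has_valence_def, rule_format, OF xy(1)] uv(2) xy(2) by linarith+
  \<comment> \<open>With p = \<open>card V\<close> and q = \<open>card E\<close>, the edge
    \<open>{u, v}\<close> gives k \<le> (2p - 1) + (p + 1) = 3p, and \<open>{x, y}\<close> gives k
    \<ge> 3 + (p + q) = 3p.\<close>
  then show ?thesis
    using vertex_label_sum_bounds(2)[OF f uv(1)] vertex_label_sum_bounds(1)[OF f xy(1)] q
    by linarith
qed

text \<open>The witness for the bijection \<open>g\<close> in \<open>S_set\<close> is the vertex
  part of \<open>f\<close> itself.\<close>

lemma valence_in_S_set:
  assumes f: "super_edge_magic_labeling V E f" and k: "has_valence E f k" and "E \<noteq> {}"
  shows "real k \<in> S_set V E"
proof -
  have "0 < card E"
    using \<open>E \<noteq> {}\<close> edges finite_vertices by (simp add: card_gt_0_iff finite_subset)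
  have "(\<Sum>u\<in>e. f (Inl u)) + f (Inr e) = k" if e: "e \<in> E" for e
  proof -
    \<comment> \<open>Distinct ends are what make the sum over \<open>e\<close> split into two
      terms.\<close>
    obtain u v where "e = {u, v}" "u \<noteq> v" using edge_obtain[OF e] .
    then show ?thesis using k e by (simp add: has_valence_def)
  qed
  then have "card E * k = (\<Sum>e\<in>E. (\<Sum>u\<in>e. f (Inl u)) + f (Inr e))"
    by simp
  also have "\<dots> = (\<Sum>u\<in>V. degree E u * f (Inl u)) + (\<Sum>e\<in>E. f (Inr e))"
    unfolding sum.distrib using edges finite_vertices
    by (subst sum_edges_eq_sum_degree[where V = V]) auto
  also have "(\<Sum>e\<in>E. f (Inr e)) = (\<Sum>i = card V + 1..card V + card E. i)"
    by (rule sum.reindex_bij_betw[OF edge_labels_bij[OF f], where g = "\<lambda>i. i"])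
  finally have "real k = real ((\<Sum>u\<in>V. degree E u * f (Inl u))
      + (\<Sum>i = card V + 1..card V + card E. i)) / real (card E)"
    using \<open>0 < card E\<close> by (simp add: field_simps flip: of_nat_mult)
  then show ?thesis
    unfolding S_set_def mem_Collect_eq using vertex_labels_bij[OF f]
    by (intro exI[of _ "\<lambda>u. f (Inl u)"] conjI)
qed

text \<open>As \<open>k\<close> is an integer, rounding the two ends of the range of
  \<open>S_set\<close> inwards cannot exclude it.\<close>

lemma valence_in_interval:
  assumes "super_edge_magic_labeling V E f" and "has_valence E f k" and "E \<noteq> {}"
  shows "int k \<in> super_edge_magic_interval V E"
proof -
  have "Min (S_set V E) \<le> real k" "real k \<le> Max (S_set V E)"
    using valence_in_S_set[OF assms] finite_S_set[OF finite_vertices] by auto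
  then show ?thesis
    by (simp add: super_edge_magic_interval_def ceiling_le_iff le_floor_iff)
qed

end

theorem theorem2p1:
  fixes V :: "'a set" and E :: "'a set set"
  assumes "fin_simple_graph V E"
    and "super_edge_magic V E"
    and "int (card E) = 2 * int (card V) - 3"
    and "girth V E = 3"
  shows "card (super_edge_magic_set V E) = 1"
proof -
  interpret fin_simple_graph V E by fact
  have q: "card E + 3 = 2 * card V" using assms(3) by linarith
  \<comment> \<open>By parity: \<open>q\<close> makes \<open>card E\<close> odd.\<close>
  then have "card E \<noteq> 0" by presburger
  then have "E \<noteq> {}" by auto
  then obtain e where "e \<in> E" by blast
  moreover obtain u v where "e = {u, v}" using edge_obtain[OF \<open>e \<in> E\<close>] .
  ultimately have uv: "{u, v} \<in> E" by simp
  have val: "has_valence E f (3 * card V) \<and> valence E f = 3 * card V"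
    if f: "super_edge_magic_labeling V E f" for f
  proof -
    obtain k where k: "has_valence E f k"
      using f by (auto simp: super_edge_magic_labeling_def edge_magic_labeling_def)
    then show ?thesis
      using valence_eq_3_card[OF f k q \<open>E \<noteq> {}\<close>] valence_eqI[OF k uv] by simp
  qed
  obtain f where f: "super_edge_magic_labeling V E f"
    using assms(2) by (auto simp: super_edge_magic_def)
  have "int (3 * card V) \<in> super_edge_magic_interval V E"
    using valence_in_interval[OF f _ \<open>E \<noteq> {}\<close>] val[OF f] by blast
  \<comment> \<open>Disabling \<open>of_nat_mult\<close> keeps \<open>int (3 * card V)\<close> in
    the form in which its membership in the interval was just shown.\<close>
  then have "super_edge_magic_set V E = {int (3 * card V)}"
    unfolding super_edge_magic_set_def using f val by (auto simp del: of_nat_mult)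
  then show ?thesis by simp
qed

end
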